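(* Let $H_1,H_2, K_1$ and $K_2$ be complex Hilbert spaces with dimensions $\geq 2$, and let $\Phi : \mathrm{soc}(B(H_1,K_1))\to \mathrm{soc}(B(H_2,K_2))$ be a bijective linear transformation. Suppose that $\Phi$ preserves rank-one operators in both directions (that is, $x$ has rank one if and only if $\Phi(x)$ has rank one). Then one of the following holds: (a) either there are bijective linear mappings $u:K_1\to K_2$ and $v:H_1\to H_2$ such that $\Phi (\xi \otimes \eta) = u(\xi) \otimes v(\eta)$ for all $\xi\in K_1$, $\eta \in H_1$; (b) or there are bijective conjugate-linear mappings $u:H_1\to K_2$ and $v:K_1\to H_2$ such that $\Phi (\xi \otimes \eta) = u(\eta) \otimes v(\xi)$ for all $\xi\in K_1$, $\eta \in H_1$.
   Context: For complex Hilbert spaces $H,K$ (inner products linear in the first variable), $B(H,K)$ is the space of bounded linear operators from $H$ to $K$. For $\xi\in K$ and $\eta\in H$, $\xi\otimes\eta\in B(H,K)$ is the operator $\zeta\mapsto\langle\zeta,\eta\rangle\xi$. The socle $\mathrm{soc}(B(H,K))$ is the linear span of the rank-one partial isometries in $B(H,K)$, i.e. the space of all finite-rank operators in $B(H,K)$. The maps $u$ and $v$ are not required to be continuous. *)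

theory Defs
  imports Complex_Main "HOL-Library.Extended_Nat" "HOL-Library.Function_Algebras"
begin

class complex_vector = ab_group_add +
  fixes scaleC :: "complex \<Rightarrow> 'a \<Rightarrow> 'a"  (infixr "*\<^sub>C" 75)
  assumes scaleC_add_right: "a *\<^sub>C (x + y) = a *\<^sub>C x + a *\<^sub>C y"
    and scaleC_add_left: "(a + b) *\<^sub>C x = a *\<^sub>C x + b *\<^sub>C x"
    and scaleC_scaleC: "a *\<^sub>C b *\<^sub>C x = (a * b) *\<^sub>C x"
    and scaleC_one: "1 *\<^sub>C x = x"

global_interpretation complex_vector:
  vector_space "scaleC :: complex \<Rightarrow> 'a \<Rightarrow> 'a::complex_vector"
  by unfold_locales (rule scaleC_add_right scaleC_add_left scaleC_scaleC scaleC_one)+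

abbreviation cspan :: "'a::complex_vector set \<Rightarrow> 'a set"
  where "cspan \<equiv> complex_vector.span"

abbreviation clinear :: "('a::complex_vector \<Rightarrow> 'b::complex_vector) \<Rightarrow> bool"
  where "clinear \<equiv> Vector_Spaces.linear scaleC scaleC"

definition conjugate_linear :: "('a::complex_vector \<Rightarrow> 'b::complex_vector) \<Rightarrow> bool"
  where "conjugate_linear f \<longleftrightarrow>
    (\<forall>x y. f (x + y) = f x + f y) \<and> (\<forall>c x. f (c *\<^sub>C x) = cnj c *\<^sub>C f x)"

text \<open>The library's \<open>dim\<close> takes the value 0 on infinite-dimensional spaces, hence the case distinction.\<close>

definition cdim :: "'a::complex_vector set \<Rightarrow> enat"
  where "cdim S =
    (if \<exists>B. finite B \<and> cspan B = cspan S then enat (complex_vector.dim S) else \<infinity>)"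

instantiation "fun" :: (type, complex_vector) complex_vector
begin

definition scaleC_fun :: "complex \<Rightarrow> ('a \<Rightarrow> 'b) \<Rightarrow> 'a \<Rightarrow> 'b"
  where "scaleC_fun c f = (\<lambda>x. c *\<^sub>C f x)"

instance
  by standard (auto simp: scaleC_fun_def fun_eq_iff scaleC_add_right scaleC_add_left
      scaleC_scaleC scaleC_one)

end

text \<open>The inner product is linear in the first argument.  Completeness is part of
  \<open>banach\<close>.\<close>

class complex_hilbert = complex_vector + banach +
  fixes cinner :: "'a \<Rightarrow> 'a \<Rightarrow> complex"
  assumes scaleR_scaleC: "r *\<^sub>R x = complex_of_real r *\<^sub>C x"
    and cinner_commute: "cinner x y = cnj (cinner y x)"
    and cinner_add_left: "cinner (x + y) z = cinner x z + cinner y z"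
    and cinner_scaleC_left: "cinner (c *\<^sub>C x) y = c * cinner x y"
    and cinner_ge_zero: "0 \<le> Re (cinner x x)"
    and cinner_eq_zero_iff: "cinner x x = 0 \<longleftrightarrow> x = 0"
    and norm_eq_sqrt_cinner: "norm x = sqrt (Re (cinner x x))"

text \<open>$B(H,K)$, as a set of functions; the vector space operations on operators are the
  pointwise ones.\<close>

definition bounded_ops :: "('h::complex_hilbert \<Rightarrow> 'k::complex_hilbert) set"
  where "bounded_ops = {T. clinear T \<and> (\<exists>M. \<forall>x. norm (T x) \<le> M * norm x)}"

definition crank :: "('h::complex_hilbert \<Rightarrow> 'k::complex_hilbert) \<Rightarrow> enat"
  where "crank T = cdim (range T)"

text \<open>A partial isometry is a bounded operator that is isometric on the orthogonal complement of
  its kernel.  The span in \<open>soc\<close> is the space of all finite-rank bounded operators.\<close>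

definition partial_isometry :: "('h::complex_hilbert \<Rightarrow> 'k::complex_hilbert) \<Rightarrow> bool"
  where "partial_isometry T \<longleftrightarrow> T \<in> bounded_ops \<and>
    (\<forall>x. (\<forall>y. T y = 0 \<longrightarrow> cinner x y = 0) \<longrightarrow> norm (T x) = norm x)"

definition soc :: "('h::complex_hilbert \<Rightarrow> 'k::complex_hilbert) set"
  where "soc = cspan {T. partial_isometry T \<and> crank T = 1}"

definition rank_one_op :: "'k::complex_hilbert \<Rightarrow> 'h::complex_hilbert \<Rightarrow> 'h \<Rightarrow> 'k"
    (infixl "\<otimes>" 70)
  where "\<xi> \<otimes> \<eta> = (\<lambda>\<zeta>. cinner \<zeta> \<eta> *\<^sub>C \<xi>)"

definition linear_on_soc ::
    "(('h1::complex_hilbert \<Rightarrow> 'k1::complex_hilbert) \<Rightarrow>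
      ('h2::complex_hilbert \<Rightarrow> 'k2::complex_hilbert)) \<Rightarrow> bool"
  where "linear_on_soc \<Phi> \<longleftrightarrow>
    (\<forall>x\<in>soc. \<forall>y\<in>soc. \<Phi> (x + y) = \<Phi> x + \<Phi> y) \<and>
    (\<forall>c. \<forall>x\<in>soc. \<Phi> (c *\<^sub>C x) = c *\<^sub>C \<Phi> x)"

end

(*
  Put F(xi, eta) = Phi(xi (x) eta).  Both F and the map (x) of the target spaces are biadditive,
  homogeneous up to conjugation, nondegenerate, and the sum of two of their values is again a value
  only if the arguments are parallel on one side; moreover they have the same values, since by the
  Riesz theorem these are exactly the elements of rank at most one.  For a fixed xi, the operators
  F(xi, eta) therefore share either their left or their right factor, and the same alternative holds
  for all xi.  In the first case F(xi, eta) = u(xi) (x) v(eta); in the second case the same argument,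
  applied to the target tensor map with its arguments exchanged, gives F(xi, eta) = u(eta) (x) v(xi).
*)
theory Submission
  imports Defs
begin

subsection \<open>Nondegenerate semi-bilinear maps\<close>

text \<open>The twist \<sigma> makes the axioms symmetric in the two arguments: it is
  \<open>id\<close> for \<xi> \<otimes> \<eta> itself and \<open>cnj\<close> once the arguments are
  exchanged. The requirement that x' and y' be nonzero lets parallelism be stated one-sidedly, as
  being a multiple of x' or of y'.\<close>

locale tensor =
  fixes t :: "'x::complex_vector \<Rightarrow> 'y::complex_vector \<Rightarrow> 'w::complex_vector"
    and \<sigma> :: "complex \<Rightarrow> complex"
  assumes sigma: "\<sigma> = id \<or> \<sigma> = cnj"
    and add_left: "t (x + x') y = t x y + t x' y"
    and add_right: "t x (y + y') = t x y + t x y'"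
    and scale_left: "t (c *\<^sub>C x) y = \<sigma> c *\<^sub>C t x y"
    and scale_right: "t x (c *\<^sub>C y) = cnj (\<sigma> c) *\<^sub>C t x y"
    and nondegenerate: "t x y = 0 \<Longrightarrow> x = 0 \<or> y = 0"
    and sum_decomposable: "t x y + t x' y' = t p q \<Longrightarrow> x' \<noteq> 0 \<Longrightarrow> y' \<noteq> 0
          \<Longrightarrow> (\<exists>k. x = k *\<^sub>C x') \<or> (\<exists>k. y = k *\<^sub>C y')"
begin

lemma sigma_sigma [simp]: "\<sigma> (\<sigma> c) = c"
  using sigma by auto

lemma sigma_cnj: "\<sigma> (cnj c) = cnj (\<sigma> c)"
  using sigma by auto

lemma sigma_minus_one: "\<sigma> (-1) = -1"
  using sigma by auto

lemma zero_left [simp]: "t 0 y = 0"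
  using add_left[of 0 0 y] by simp

lemma zero_right [simp]: "t x 0 = 0"
  using add_right[of x 0 0] by simp

lemma eq_zero_iff: "t x y = 0 \<longleftrightarrow> x = 0 \<or> y = 0"
  using nondegenerate by auto

lemma diff_left: "t (x - x') y = t x y - t x' y"
  using add_left[of "x - x'" x' y] by (simp add: algebra_simps)

lemma diff_right: "t x (y - y') = t x y - t x y'"
  using add_right[of x "y - y'" y'] by (simp add: algebra_simps)

lemma cancel_left: "x \<noteq> 0 \<Longrightarrow> t x y = t x y' \<Longrightarrow> y = y'"
  using nondegenerate[of x "y - y'"] by (simp add: diff_right)

lemma cancel_right: "y \<noteq> 0 \<Longrightarrow> t x y = t x' y \<Longrightarrow> x = x'"
  using nondegenerate[of "x - x'" y] by (simp add: diff_left)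

lemma scale_into_left: "k *\<^sub>C t x y = t (\<sigma> k *\<^sub>C x) y"
  by (simp add: scale_left)

lemma scale_into_right: "k *\<^sub>C t x y = t x (\<sigma> (cnj k) *\<^sub>C y)"
  by (simp add: scale_right)

text \<open>Every result about left factors thereby has a counterpart for right factors, with the
  twist conjugated.\<close>

lemma tensor_swap: "tensor (\<lambda>y x. t x y) (\<lambda>c. cnj (\<sigma> c))"
proof
  show "(\<lambda>c. cnj (\<sigma> c)) = id \<or> (\<lambda>c. cnj (\<sigma> c)) = cnj"
    using sigma by auto
  show "y = 0 \<or> x = 0" if "t x y = 0" for x y
    using nondegenerate[OF that] by blast
  show "(\<exists>k. y = k *\<^sub>C y') \<or> (\<exists>k. x = k *\<^sub>C x')"
    if "t x y + t x' y' = t p q" "y' \<noteq> 0" "x' \<noteq> 0" for x y x' y' p q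
    using sum_decomposable[OF that(1,3,2)] by blast
qed (simp_all add: add_left add_right scale_left scale_right)

text \<open>For x nonzero, \<open>t x\<close> is injective and semilinear, so the preimage of a line
  is contained in a line.\<close>

lemma same_line:
  assumes "x \<noteq> 0" "y' \<noteq> 0" "t x y = k *\<^sub>C p" "t x y' = k' *\<^sub>C p"
  shows "\<exists>c. y = c *\<^sub>C y'"
proof -
  have "k' \<noteq> 0"
    using assms nondegenerate by fastforce
  then have "t x y = (k / k') *\<^sub>C t x y'"
    using assms by simp
  then show ?thesis
    using cancel_left[OF assms(1)] scale_into_right by metis
qed

text \<open>Nonzero decomposable values determine their factors up to scalars: the difference of the
  two sides is the value 0, so the axiom on sums makes one pair of factors parallel, and cancelling
  that pair makes the other parallel too.\<close>

lemma factor_left: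
  assumes "t p q = t p' q'" "p \<noteq> 0" "q \<noteq> 0"
  shows "\<exists>k. p = k *\<^sub>C p'"
proof (rule ccontr)
  assume no: "\<not> ?thesis"
  have nz: "p' \<noteq> 0" "q' \<noteq> 0"
    using assms eq_zero_iff by metis+
  have "t p q + t ((-1) *\<^sub>C p') q' = t 0 0"
    unfolding scale_left sigma_minus_one using assms by simp
  then have "(\<exists>k. p = k *\<^sub>C (-1) *\<^sub>C p') \<or> (\<exists>k. q = k *\<^sub>C q')"
    using sum_decomposable nz by (metis complex_vector.scale_eq_0_iff neg_equal_0_iff_equal zero_neq_one)
  with no obtain k where k: "q = k *\<^sub>C q'"
    by (metis complex_vector.scale_scale)
  \<comment> \<open>A scalar crosses from one factor to the other by conjugation, whichever of the
    two twists \<sigma> is.\<close>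
  then have "t ((cnj k) *\<^sub>C p) q' = t p' q'"
    using assms by (simp add: scale_left scale_right sigma_cnj)
  then have "cnj k *\<^sub>C p = p'"
    using cancel_right nz by blast
  moreover have "cnj k \<noteq> 0"
    using calculation nz by auto
  ultimately have "p = (1 / cnj k) *\<^sub>C p'"
    by auto
  with no show False by blast
qed

end

text \<open>The factor of proportionality is constant because, when g y and g y0 are independent,
  the factor at y + y0 must agree with both the factor at y and the one at y0; on the line of y0 it
  is constant by semilinearity.\<close>

lemma proportional_maps:
  fixes f g :: "'y::complex_vector \<Rightarrow> 'w::complex_vector"
  assumes f_add: "\<And>x y. f (x + y) = f x + f y" and g_add: "\<And>x y. g (x + y) = g x + g y"
    and f_scale: "\<And>c y. f (c *\<^sub>C y) = \<rho> c *\<^sub>C f y" and g_scale: "\<And>c y. g (c *\<^sub>C y) = \<rho> c *\<^sub>C g y"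
    and g_inj: "\<And>y. g y = 0 \<Longrightarrow> y = 0" and surj: "surj \<rho>"
    and pointwise: "\<And>y. \<exists>k. f y = k *\<^sub>C g y"
  shows "\<exists>k. \<forall>y. f y = k *\<^sub>C g y"
proof (cases "\<exists>y0::'y. y0 \<noteq> 0")
  case False
  then have "f y = 0 *\<^sub>C g y" for y
    using f_add[of 0 0] by (metis add_cancel_right_right complex_vector.scale_zero_left)
  then show ?thesis by blast
next
  case True
  then obtain y0 :: 'y where "y0 \<noteq> 0" by blast
  then have g0: "g y0 \<noteq> 0" using g_inj by blast
  obtain k0 where k0: "f y0 = k0 *\<^sub>C g y0" using pointwise by blast
  have "f y = k0 *\<^sub>C g y" for y
  proof (cases "\<exists>c. g y = c *\<^sub>C g y0")
    case True
    \<comment> \<open>Writing the coefficient as a value of \<rho> turns the multiple of g y0 into g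
      of a multiple of y0, so that injectivity of g applies.\<close>
    then obtain d where "g y = \<rho> d *\<^sub>C g y0" using surj by (metis surjD)
    then have "g (y + (d *\<^sub>C (-1) *\<^sub>C y0)) = 0"
    proof -
      have "g 0 = 0" using g_add[of 0 0] by simp
      then have "g ((-1) *\<^sub>C y0) = - g y0"
        using g_add[of "y0" "(-1) *\<^sub>C y0"] by (simp add: eq_neg_iff_add_eq_0 add.commute)
      then show ?thesis
        using \<open>g y = \<rho> d *\<^sub>C g y0\<close> by (simp only: g_add g_scale) simp
    qed
    then have "y = d *\<^sub>C y0"
      using g_inj by (metis complex_vector.scale_minus_left complex_vector.scale_minus_right complex_vector.scale_one eq_neg_iff_add_eq_0 minus_minus)
    then show ?thesis
      using k0 by (simp add: f_scale g_scale mult.commute)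
  next
    case False
    obtain k1 where k1: "f y = k1 *\<^sub>C g y" using pointwise by blast
    obtain k2 where k2: "f (y + y0) = k2 *\<^sub>C g (y + y0)" using pointwise by blast
    \<comment> \<open>Both expansions of f (y + y0) are compared.\<close>
    have "(k1 - k2) *\<^sub>C g y = (k2 - k0) *\<^sub>C g y0"
      using k0 k1 k2 by (simp add: f_add g_add complex_vector.scale_left_diff_distrib
          complex_vector.scale_right_distrib algebra_simps)
    moreover have "k1 = k2"
    proof (rule ccontr)
      assume "k1 \<noteq> k2"
      then have "g y = ((k2 - k0) / (k1 - k2)) *\<^sub>C g y0"
        using calculation
        by (metis complex_vector.scale_left_imp_eq complex_vector.scale_scale nonzero_mult_div_cancel_left
            right_minus_eq times_divide_eq_right)
      then show False using False by blast
    qed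
    ultimately show ?thesis
      using g0 k1 by simp
  qed
  then show ?thesis by blast
qed

section \<open>Two tensor maps with the same set of values\<close>

text \<open>\<open>F\<close> will be the transformation applied to \<xi> \<otimes> \<eta>, and
  \<open>t\<close> the tensor map of the target, possibly with exchanged arguments. The fixed
  vectors \<open>y\<^sub>1\<close>, \<open>y\<^sub>2\<close> are independent witnesses of dimension
  at least 2.\<close>

locale tensor_pair = F: tensor F \<sigma> + t: tensor t \<tau>
  for F :: "'x::complex_vector \<Rightarrow> 'y::complex_vector \<Rightarrow> 'w::complex_vector" and \<sigma>
  and t :: "'p::complex_vector \<Rightarrow> 'q::complex_vector \<Rightarrow> 'w" and \<tau> +
  fixes y\<^sub>1 y\<^sub>2 :: 'y
  assumes F_decomposable: "\<exists>p q. F x y = t p q"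
    and t_decomposable: "\<exists>x y. t p q = F x y"
    and y1: "y\<^sub>1 \<noteq> 0" and y2: "\<nexists>k. y\<^sub>2 = k *\<^sub>C y\<^sub>1"
    and x_nontrivial: "\<exists>x::'x. x \<noteq> 0"
begin

lemma y2_nonzero: "y\<^sub>2 \<noteq> 0"
  using y2 by (metis complex_vector.scale_zero_left)

text \<open>With \<open>y2\<close>, this says that \<open>y\<^sub>1\<close>,
  \<open>y\<^sub>2\<close> and their sum span three distinct lines, which two lines cannot
  cover.\<close>

lemma not_parallel:
  "\<nexists>k. y\<^sub>1 = k *\<^sub>C y\<^sub>2" "\<nexists>k. y\<^sub>1 + y\<^sub>2 = k *\<^sub>C y\<^sub>1" "\<nexists>k. y\<^sub>1 + y\<^sub>2 = k *\<^sub>C y\<^sub>2"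
proof -
  show *: "\<nexists>k. y\<^sub>1 = k *\<^sub>C y\<^sub>2"
  proof
    assume "\<exists>k. y\<^sub>1 = k *\<^sub>C y\<^sub>2"
    then obtain k where k: "y\<^sub>1 = k *\<^sub>C y\<^sub>2" by blast
    then have "k \<noteq> 0" using y1 by auto
    then have "y\<^sub>2 = (1 / k) *\<^sub>C y\<^sub>1" using k by simp
    then show False using y2 by blast
  qed
  have "y\<^sub>2 = (k - 1) *\<^sub>C y\<^sub>1" if "y\<^sub>1 + y\<^sub>2 = k *\<^sub>C y\<^sub>1" for k
    using that by (simp add: complex_vector.scale_left_diff_distrib algebra_simps)
  then show "\<nexists>k. y\<^sub>1 + y\<^sub>2 = k *\<^sub>C y\<^sub>1" using y2 by blast
  have "y\<^sub>1 = (k - 1) *\<^sub>C y\<^sub>2" if "y\<^sub>1 + y\<^sub>2 = k *\<^sub>C y\<^sub>2" for k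
    using that by (simp add: complex_vector.scale_left_diff_distrib algebra_simps)
  then show "\<nexists>k. y\<^sub>1 + y\<^sub>2 = k *\<^sub>C y\<^sub>2" using * by blast
qed

lemma tensor_pair_swap: "tensor_pair F \<sigma> (\<lambda>q p. t p q) (\<lambda>c. cnj (\<tau> c)) y\<^sub>1 y\<^sub>2"
proof -
  interpret s: tensor "\<lambda>q p. t p q" "\<lambda>c. cnj (\<tau> c)"
    by (rule t.tensor_swap)
  show ?thesis
    by unfold_locales (use F_decomposable t_decomposable y1 y2 x_nontrivial in metis)+
qed

definition left_type :: "'x \<Rightarrow> bool"
  where "left_type x \<longleftrightarrow> (\<exists>p. \<forall>y. \<exists>q. F x y = t p q)"

definition right_type :: "'x \<Rightarrow> bool"
  where "right_type x \<longleftrightarrow> (\<exists>q. \<forall>y. \<exists>p. F x y = t p q)"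

text \<open>The sum of the two values is F x (y + y'), again a value of \<open>t\<close>.\<close>

lemma sum_parallel:
  assumes "F x y = t p q" "F x y' = t p' q'" "p' \<noteq> 0" "q' \<noteq> 0"
  shows "(\<exists>k. p = k *\<^sub>C p') \<or> (\<exists>k. q = k *\<^sub>C q')"
  using assms F_decomposable[of x "y + y'"] t.sum_decomposable by (metis F.add_right)

lemma sum_parallel':
  assumes "F x y = t p q" "F x' y = t p' q'" "p' \<noteq> 0" "q' \<noteq> 0"
  shows "(\<exists>k. p = k *\<^sub>C p') \<or> (\<exists>k. q = k *\<^sub>C q')"
  using assms F_decomposable[of "x + x'" y] t.sum_decomposable by (metis F.add_left)

text \<open>If F x y = t r s with r not parallel to p, then both \<open>q\<^sub>1\<close> and
  \<open>q\<^sub>2\<close> are multiples of s. Hence F x sends \<open>y\<^sub>1\<close> and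
  \<open>y\<^sub>2\<close> into the single line of t p s, against their independence.\<close>

lemma common_left_factor:
  assumes "x \<noteq> 0" "F x y\<^sub>1 = t p q\<^sub>1" "F x y\<^sub>2 = t p q\<^sub>2"
  shows "\<exists>q. F x y = t p q"
proof (cases "y = 0")
  case True
  then show ?thesis by (metis F.zero_right t.zero_right)
next
  case False
  obtain r s where rs: "F x y = t r s" using F_decomposable by blast
  have nz: "r \<noteq> 0" "s \<noteq> 0" "p \<noteq> 0" "q\<^sub>1 \<noteq> 0" "q\<^sub>2 \<noteq> 0"
    using rs assms False y1 y2_nonzero by (metis F.eq_zero_iff t.eq_zero_iff)+
  show ?thesis
  proof (cases "\<exists>k. r = k *\<^sub>C p")
    case True
    then obtain k where "r = k *\<^sub>C p" by blast
    \<comment> \<open>For either twist the scalar \<tau> (cnj (\<tau> k)) is just cnj k.\<close>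
    then have "F x y = t p (\<tau> (cnj (\<tau> k)) *\<^sub>C s)"
      using rs by (metis t.scale_left t.scale_into_right)
    then show ?thesis by blast
  next
    case False
    have not: "\<nexists>k. p = k *\<^sub>C r"
    proof
      assume "\<exists>k. p = k *\<^sub>C r"
      then obtain k where "p = k *\<^sub>C r" by blast
      moreover from this have "k \<noteq> 0" using nz by auto
      ultimately have "r = (1 / k) *\<^sub>C p" by simp
      with False show False by blast
    qed
    obtain k\<^sub>1 where k1: "q\<^sub>1 = k\<^sub>1 *\<^sub>C s"
      using sum_parallel[OF assms(2) rs nz(1,2)] not by blast
    obtain k\<^sub>2 where k2: "q\<^sub>2 = k\<^sub>2 *\<^sub>C s"
      using sum_parallel[OF assms(3) rs nz(1,2)] not by blast
    have "\<exists>c. y\<^sub>2 = c *\<^sub>C y\<^sub>1"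
      using F.same_line[OF assms(1) y1, of y\<^sub>2 _ "t p s"] assms k1 k2 by (metis t.scale_right)
    then show ?thesis using y2 by blast
  qed
qed

text \<open>The values at \<open>y\<^sub>1\<close> and \<open>y\<^sub>2\<close> have parallel left
  or parallel right factors; after absorbing the scalar they share one, and
  \<open>common_left_factor\<close>, for the pair or its swap, extends this to all y.\<close>

lemma left_or_right: "left_type x \<or> right_type x"
proof (cases "x = 0")
  case True
  then show ?thesis unfolding left_type_def by (metis F.zero_left t.zero_right)
next
  case False
  interpret s: tensor_pair F \<sigma> "\<lambda>q p. t p q" "\<lambda>c. cnj (\<tau> c)" y\<^sub>1 y\<^sub>2
    by (rule tensor_pair_swap)
  obtain p\<^sub>1 q\<^sub>1 p\<^sub>2 q\<^sub>2 where pq: "F x y\<^sub>1 = t p\<^sub>1 q\<^sub>1" "F x y\<^sub>2 = t p\<^sub>2 q\<^sub>2"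
    using F_decomposable by meson
  have nz: "p\<^sub>1 \<noteq> 0" "q\<^sub>1 \<noteq> 0"
    using pq False y1 by (metis F.eq_zero_iff t.eq_zero_iff)+
  consider k where "p\<^sub>2 = k *\<^sub>C p\<^sub>1" | k where "q\<^sub>2 = k *\<^sub>C q\<^sub>1"
    using sum_parallel[OF pq(2,1) nz] by blast
  then show ?thesis
  proof cases
    case 1
    then have "F x y\<^sub>2 = t p\<^sub>1 (\<tau> (cnj (\<tau> k)) *\<^sub>C q\<^sub>2)"
      using pq by (metis t.scale_left t.scale_into_right)
    then show ?thesis
      unfolding left_type_def using common_left_factor[OF False pq(1)] by blast
  next
    case 2
    then have "F x y\<^sub>2 = t (\<tau> (cnj (\<tau> k)) *\<^sub>C p\<^sub>2) q\<^sub>1"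
      using pq by (metis t.scale_right t.scale_into_left)
    then show ?thesis
      unfolding right_type_def using s.common_left_factor[OF False pq(1)] by blast
  qed
qed

text \<open>Suppose x is only of left type, with factor p, and x' only of right type, with factor q.
  Since F (x + x') y is decomposable, for each y one of F x y and F x' y lies on the line of t p q.
  The space of all y would then be a union of two lines.\<close>

lemma uniform_type: "(\<forall>x. left_type x) \<or> (\<forall>x. right_type x)"
proof (rule ccontr)
  assume "\<not> ?thesis"
  then obtain x x' where nl: "\<not> left_type x'" and nr: "\<not> right_type x" by blast
  then have "left_type x" "right_type x'" using left_or_right by blast+
  then obtain p q where p: "\<And>y. \<exists>q. F x y = t p q" and q: "\<And>y. \<exists>p. F x' y = t p q"
    unfolding left_type_def right_type_def by blast
  have x: "x \<noteq> 0" using nr unfolding right_type_def by (metis F.zero_left t.zero_right)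
  have x': "x' \<noteq> 0" using nl unfolding left_type_def by (metis F.zero_left t.zero_right)
  have pnz: "p \<noteq> 0" using p[of y\<^sub>1] x y1 by (metis F.eq_zero_iff t.zero_left)
  have qnz: "q \<noteq> 0" using q[of y\<^sub>1] x' y1 by (metis F.eq_zero_iff t.zero_right)
  define A where "A = {y. \<exists>k. F x y = k *\<^sub>C t p q}"
  define B where "B = {y. \<exists>k. F x' y = k *\<^sub>C t p q}"
  have cover: "y \<in> A \<or> y \<in> B" for y
  proof -
    obtain r s where rs: "F x y = t p r" "F x' y = t s q" using p q by meson
    show ?thesis
    proof (cases "s = 0 \<or> r = 0")
      case True
      then have "y = 0" using rs x x' by (metis F.eq_zero_iff t.zero_left t.zero_right)
      then show ?thesis unfolding A_def by (auto intro: exI[of _ 0])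
    next
      case False
      with sum_parallel'[OF rs(2,1) pnz] consider k where "s = k *\<^sub>C p" | k where "q = k *\<^sub>C r"
        by blast
      then show ?thesis
      proof cases
        case 1
        then show ?thesis using rs unfolding B_def by (auto simp: t.scale_left)
      next
        case 2
        then have "k \<noteq> 0" using qnz by auto
        then have "r = (1 / k) *\<^sub>C q" using 2 by simp
        then show ?thesis using rs unfolding A_def by (auto simp: t.scale_right)
      qed
    qed
  qed
  have lineA: "\<exists>c. y = c *\<^sub>C y'" if "y \<in> A" "y' \<in> A" "y' \<noteq> 0" for y y'
    using that F.same_line[OF x] unfolding A_def by blast
  have lineB: "\<exists>c. y = c *\<^sub>C y'" if "y \<in> B" "y' \<in> B" "y' \<noteq> 0" for y y'
    using that F.same_line[OF x'] unfolding B_def by blast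
  \<comment> \<open>Two of the three pairwise independent vectors fall into the same one of the sets
    \<open>A\<close> and \<open>B\<close>.\<close>
  show False
    using cover[of y\<^sub>1] cover[of y\<^sub>2] cover[of "y\<^sub>1 + y\<^sub>2"] lineA lineB y1 y2_nonzero not_parallel y2
    by blast
qed

text \<open>A fixed nonzero x0 defines v as its right factor; the point is that the same v serves
  every x. Both maps carry the twist \<tau> (\<sigma> c), hence are linear if the twists agree and
  conjugate-linear otherwise.\<close>

lemma left_type_factors:
  assumes all: "\<And>x. left_type x"
  shows "\<exists>(u::'x \<Rightarrow> 'p) (v::'y \<Rightarrow> 'q).
    (\<forall>x x'. u (x + x') = u x + u x') \<and> (\<forall>c x. u (c *\<^sub>C x) = \<tau> (\<sigma> c) *\<^sub>C u x) \<and> bij u \<and>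
    (\<forall>y y'. v (y + y') = v y + v y') \<and> (\<forall>c y. v (c *\<^sub>C y) = \<tau> (\<sigma> c) *\<^sub>C v y) \<and> bij v \<and>
    (\<forall>x y. F x y = t (u x) (v y))"
proof -
  obtain x0 :: 'x where x0: "x0 \<noteq> 0" using x_nontrivial by blast
  obtain p0 v where v: "\<And>y. F x0 y = t p0 (v y)"
    using all[of x0] unfolding left_type_def by metis
  have p0: "p0 \<noteq> 0" using v[of y\<^sub>1] x0 y1 by (metis F.eq_zero_iff t.zero_left)
  have v_add: "v (y + y') = v y + v y'" for y y'
    by (rule t.cancel_left[OF p0]) (simp add: t.add_right F.add_right flip: v)
  have v_scale: "v (c *\<^sub>C y) = \<tau> (\<sigma> c) *\<^sub>C v y" for c y
    by (rule t.cancel_left[OF p0]) (simp add: t.scale_right F.scale_right flip: v)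
  have v_nz: "y = 0" if "v y = 0" for y
    using v[of y] that x0 F.nondegenerate by fastforce
  have "\<exists>w. \<forall>y. F x y = t w (v y)" for x
  proof (cases "\<exists>k. x = k *\<^sub>C x0")
    case True
    then obtain k where "x = k *\<^sub>C x0" by blast
    then have "F x y = t (\<tau> (\<sigma> k) *\<^sub>C p0) (v y)" for y
      using v by (simp add: F.scale_left t.scale_left)
    then show ?thesis by blast
  next
    case False
    then have x: "x \<noteq> 0" by (metis complex_vector.scale_zero_left)
    obtain p b where p: "\<And>y. F x y = t p (b y)"
      using all[of x] unfolding left_type_def by metis
    have pnz: "p \<noteq> 0" using p[of y\<^sub>1] x y1 by (metis F.eq_zero_iff t.zero_left)
    \<comment> \<open>If p were parallel to p0, then F x \<open>y\<^sub>2\<close> + F x0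
      \<open>y\<^sub>1\<close> would have left factor p0 and be a value of \<open>F\<close>. The
      axiom on sums for \<open>F\<close> excludes this, since neither x, x0 nor
      \<open>y\<^sub>2\<close>, \<open>y\<^sub>1\<close> are parallel.\<close>
    have notp: "\<nexists>k. p = k *\<^sub>C p0"
    proof
      assume "\<exists>k. p = k *\<^sub>C p0"
      then obtain k where "p = k *\<^sub>C p0" by blast
      then have "F x y\<^sub>2 = t p0 (\<tau> (cnj (\<tau> k)) *\<^sub>C b y\<^sub>2)"
        using p by (metis t.scale_left t.scale_into_right)
      then have "\<exists>r. F x y\<^sub>2 + F x0 y\<^sub>1 = t p0 r" using v by (metis t.add_right)
      then have "\<exists>r s. F x y\<^sub>2 + F x0 y\<^sub>1 = F r s" using t_decomposable by metis
      then show False using F.sum_decomposable x0 y1 False y2 by blast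
    qed
    \<comment> \<open>As F (x + x0) y is decomposable and p, p0 are not parallel, the right factors
      b y and v y must be; the scalar still depends on y.\<close>
    have "\<exists>k. F x y = k *\<^sub>C t p (v y)" for y
    proof (cases "y = 0")
      case False
      then have "v y \<noteq> 0" using v_nz by blast
      then obtain k where "b y = k *\<^sub>C v y"
        using sum_parallel'[OF p v p0] notp by blast
      then show ?thesis using p by (auto simp: t.scale_right)
    qed (auto intro: exI[of _ 0])
    then have "\<exists>k. \<forall>y. F x y = k *\<^sub>C t p (v y)"
    proof (intro proportional_maps[where \<rho> = "\<lambda>c. cnj (\<sigma> c)"])
      show "surj (\<lambda>c. cnj (\<sigma> c))"
        by (rule surjI[of _ "\<lambda>c. \<sigma> (cnj c)"]) simp
    qed (use pnz v_nz in \<open>auto simp: F.add_right F.scale_right v_add v_scale t.add_right t.scale_right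
        dest: t.nondegenerate\<close>)
    then show ?thesis by (metis t.scale_into_left)
  qed
  then obtain u where u: "\<And>x y. F x y = t (u x) (v y)" by metis
  have vy1: "v y\<^sub>1 \<noteq> 0" using v_nz y1 by blast
  have u_add: "u (x + x') = u x + u x'" for x x'
    by (rule t.cancel_right[OF vy1]) (simp add: t.add_left F.add_left flip: u)
  have u_scale: "u (c *\<^sub>C x) = \<tau> (\<sigma> c) *\<^sub>C u x" for c x
    by (rule t.cancel_right[OF vy1]) (simp add: t.scale_left F.scale_left flip: u)
  have "inj u"
    by (rule injI) (metis F.cancel_right u y1)
  have "inj v"
    by (rule injI) (metis F.cancel_left v x0)
  \<comment> \<open>Every scalar is of the form \<tau> (\<sigma> c), so multiples of values of u or
    v are again values.\<close>
  have inv: "\<tau> (\<sigma> (\<sigma> (\<tau> k))) = k" for k by simp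
  interpret s: tensor "\<lambda>q p. t p q" "\<lambda>c. cnj (\<tau> c)"
    by (rule t.tensor_swap)
  have "\<exists>x. p = u x" for p
  proof (cases "p = 0")
    case True
    then show ?thesis using u_scale[of 0 0] by (metis F.zero_left t.eq_zero_iff u vy1)
  next
    case False
    \<comment> \<open>Decomposability in the reverse direction gives surjectivity: uniqueness of
      factors makes p a multiple of some u x.\<close>
    obtain x y where "t p (v y\<^sub>1) = t (u x) (v y)" using t_decomposable u by metis
    then obtain k where "p = k *\<^sub>C u x" using t.factor_left False vy1 by blast
    then show ?thesis using u_scale inv by metis
  qed
  then have "surj u" by blast
  have "\<exists>y. q = v y" for q
  proof (cases "q = 0")
    case True
    then show ?thesis by (metis F.zero_right t.eq_zero_iff v p0)
  next
    case False
    obtain x y where "t p0 q = t (u x) (v y)" using t_decomposable u by metis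
    then obtain k where "q = k *\<^sub>C v y" using s.factor_left False p0 by blast
    then show ?thesis using v_scale inv by metis
  qed
  then have "surj v" by blast
  show ?thesis
    using u_add u_scale v_add v_scale u \<open>inj u\<close> \<open>inj v\<close> \<open>surj u\<close> \<open>surj v\<close>
    unfolding bij_def by blast
qed

end

subsection \<open>Complex Hilbert spaces and rank-one operators\<close>

lemma cinner_zero_left [simp]: "cinner 0 x = 0"
  using cinner_add_left[of 0 0 x] by simp

lemma cinner_add_right: "cinner x (y + z) = cinner x y + cinner x z"
  using cinner_add_left[of y z x] cinner_commute by (metis complex_cnj_add)

lemma cinner_scaleC_right: "cinner x (c *\<^sub>C y) = cnj c * cinner x y"
  using cinner_scaleC_left[of c y x] cinner_commute by (metis complex_cnj_mult)

lemma cinner_diff_left: "cinner (x - y) z = cinner x z - cinner y z"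
  using cinner_add_left[of "x - y" y z] by simp

lemma cinner_diff_right: "cinner x (y - z) = cinner x y - cinner x z"
  using cinner_add_right[of x "y - z" z] by simp

lemma cinner_zero_right [simp]: "cinner x 0 = 0"
  using cinner_add_right[of x 0 0] by simp

lemma cinner_self: "cinner x x = complex_of_real ((norm x)\<^sup>2)"
proof -
  have "Im (cinner x x) = 0"
    using cinner_commute[of x x] by (metis cnj.simps(2) neg_equal_zero)
  then show ?thesis
    by (simp add: complex_eq_iff norm_eq_sqrt_cinner cinner_ge_zero)
qed

lemma norm_scaleC: "norm (c *\<^sub>C x) = cmod c * norm (x::'a::complex_hilbert)"
proof -
  have "complex_of_real ((norm (c *\<^sub>C x))\<^sup>2) = complex_of_real ((cmod c * norm x)\<^sup>2)"
    unfolding cinner_self[symmetric] cinner_scaleC_left cinner_scaleC_right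
    using complex_norm_square[of c]
    by (simp add: cinner_self power_mult_distrib mult.commute)
  then have "(norm (c *\<^sub>C x))\<^sup>2 = (cmod c * norm x)\<^sup>2"
    by (simp only: of_real_eq_iff)
  then show ?thesis by (rule power2_eq_imp_eq) simp_all
qed

lemma parallelogram:
  "(norm (x - y))\<^sup>2 + (norm (x + y))\<^sup>2 = 2 * (norm x)\<^sup>2 + 2 * (norm (y::'a::complex_hilbert))\<^sup>2"
proof -
  have "complex_of_real ((norm (x - y))\<^sup>2 + (norm (x + y))\<^sup>2)
      = complex_of_real (2 * (norm x)\<^sup>2 + 2 * (norm y)\<^sup>2)"
    unfolding of_real_add of_real_mult cinner_self[symmetric]
    by (simp add: cinner_add_left cinner_add_right cinner_diff_left cinner_diff_right)
  then show ?thesis using of_real_eq_iff by blast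
qed

text \<open>Pythagoras for the projection onto the line of e. As the left side is nonnegative, this
  contains the Cauchy-Schwarz inequality for a unit vector.\<close>

lemma cmod_cinner_unit:
  assumes "norm (e::'a::complex_hilbert) = 1"
  shows "(norm (x - cinner x e *\<^sub>C e))\<^sup>2 = (norm x)\<^sup>2 - (cmod (cinner x e))\<^sup>2"
proof -
  have "complex_of_real ((norm (x - cinner x e *\<^sub>C e))\<^sup>2) = complex_of_real ((norm x)\<^sup>2 - (cmod (cinner x e))\<^sup>2)"
    unfolding of_real_diff cinner_self[symmetric]
    using assms cinner_commute[of e x] cinner_self[of e]
    by (simp add: cinner_diff_left cinner_diff_right cinner_scaleC_left cinner_scaleC_right
        complex_norm_square[unfolded of_real_power])
  then show ?thesis using of_real_eq_iff by blast
qed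

text \<open>Subtracting from x its projection onto the line of h lowers the squared norm by the
  squared modulus of the coefficient, which must therefore vanish.\<close>

lemma orthogonal_of_minimal:
  fixes x h :: "'a::complex_hilbert"
  assumes min: "\<And>c. norm x \<le> norm (x - c *\<^sub>C h)"
  shows "cinner h x = 0"
proof (cases "h = 0")
  case False
  define e where "e = (1 / complex_of_real (norm h)) *\<^sub>C h"
  have e: "norm e = 1" using False by (simp add: e_def norm_scaleC norm_divide)
  have "norm x \<le> norm (x - cinner x e *\<^sub>C e)"
    using min unfolding e_def by (simp add: complex_vector.scale_scale)
  then have "(norm x)\<^sup>2 \<le> (norm (x - cinner x e *\<^sub>C e))\<^sup>2" by simp
  then have "cinner x e = 0" unfolding cmod_cinner_unit[OF e] by simp
  then have "cinner x h = 0" using False by (simp add: e_def cinner_scaleC_right)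
  then show ?thesis using cinner_commute[of h x] by simp
qed simp

section \<open>The Riesz representation theorem\<close>

text \<open>A minimizing sequence in the hyperplane f = 1 is Cauchy by the parallelogram law, and
  boundedness of f keeps its limit in the hyperplane.\<close>

lemma minimal_norm_exists:
  fixes f :: "'a::complex_hilbert \<Rightarrow> complex"
  assumes add: "\<And>x y. f (x + y) = f x + f y" and scale: "\<And>c x. f (c *\<^sub>C x) = c * f x"
    and bound: "\<And>x. cmod (f x) \<le> M * norm x" and "f z \<noteq> 0"
  shows "\<exists>x. f x = 1 \<and> (\<forall>y. f y = 1 \<longrightarrow> norm x \<le> norm y)"
proof -
  define N where "N = norm ` {y. f y = 1}"
  define d where "d = Inf N"
  have "f ((1 / f z) *\<^sub>C z) = 1" using assms(4) by (simp add: scale)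
  then have "N \<noteq> {}" unfolding N_def by blast
  have bdd: "bdd_below N" unfolding N_def by (rule bdd_belowI[of _ 0]) auto
  have d_le: "d \<le> norm y" if "f y = 1" for y
    unfolding d_def using bdd that by (intro cInf_lower) (auto simp: N_def)
  have "0 \<le> d"
    unfolding d_def using \<open>N \<noteq> {}\<close> by (intro cInf_greatest) (auto simp: N_def)
  have "\<exists>y. f y = 1 \<and> norm y < d + 1 / real (Suc n)" for n
  proof -
    have "\<exists>r\<in>N. r < d + 1 / real (Suc n)"
      using cInf_less_iff[OF \<open>N \<noteq> {}\<close> bdd, of "d + 1 / real (Suc n)"]
      unfolding d_def[symmetric] by simp
    then show ?thesis unfolding N_def by auto
  qed
  then have "\<exists>X. \<forall>n. f (X n) = 1 \<and> norm (X n) < d + 1 / real (Suc n)"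
    by (intro choice allI)
  then obtain X where X: "\<And>n. f (X n) = 1" "\<And>n. norm (X n) < d + 1 / real (Suc n)"
    by blast
  have lim: "(\<lambda>n. norm (X n)) \<longlonglongrightarrow> d"
  proof (rule tendsto_sandwich[where f = "\<lambda>_. d" and h = "\<lambda>n. d + 1 / real (Suc n)"])
    have "(\<lambda>n. d + 1 / real (Suc n)) \<longlonglongrightarrow> d + 0"
      using LIMSEQ_inverse_real_of_nat by (intro tendsto_add tendsto_const) (simp add: inverse_eq_divide)
    then show "(\<lambda>n. d + 1 / real (Suc n)) \<longlonglongrightarrow> d" by simp
    show "eventually (\<lambda>n. d \<le> norm (X n)) sequentially"
      using d_le X(1) by simp
    show "eventually (\<lambda>n. norm (X n) \<le> d + 1 / real (Suc n)) sequentially"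
      by (intro always_eventually allI less_imp_le X(2))
  qed simp
  have dist: "(norm (X m - X n))\<^sup>2 \<le> 2 * ((norm (X m))\<^sup>2 - d\<^sup>2) + 2 * ((norm (X n))\<^sup>2 - d\<^sup>2)" for m n
  proof -
    \<comment> \<open>The midpoint stays in the hyperplane, so its norm is at least d.\<close>
    have "f ((1 / 2) *\<^sub>C (X m + X n)) = 1" by (simp add: scale add X)
    then have "d \<le> norm ((1 / 2) *\<^sub>C (X m + X n))" by (rule d_le)
    then have "2 * d \<le> norm (X m + X n)" by (simp add: norm_scaleC norm_divide)
    then have "(2 * d)\<^sup>2 \<le> (norm (X m + X n))\<^sup>2" using \<open>0 \<le> d\<close> by (intro power_mono) auto
    then show ?thesis using parallelogram[of "X m" "X n"] by (simp add: power_mult_distrib)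
  qed
  have "Cauchy X"
  proof (rule metric_CauchyI)
    fix e :: real assume "0 < e"
    have "(\<lambda>n. (norm (X n))\<^sup>2 - d\<^sup>2) \<longlonglongrightarrow> d\<^sup>2 - d\<^sup>2"
      by (intro tendsto_intros lim)
    \<comment> \<open>The two terms in \<open>dist\<close> each have weight 2, hence the threshold
      of a quarter.\<close>
    then have "eventually (\<lambda>n. (norm (X n))\<^sup>2 - d\<^sup>2 < e\<^sup>2 / 4) sequentially"
      using \<open>0 < e\<close> by (intro order_tendstoD(2)[where y = "d\<^sup>2 - d\<^sup>2"]) auto
    then obtain K where K: "\<And>n. n \<ge> K \<Longrightarrow> (norm (X n))\<^sup>2 - d\<^sup>2 < e\<^sup>2 / 4"
      unfolding eventually_sequentially by blast
    have "dist (X m) (X n) < e" if "m \<ge> K" "n \<ge> K" for m n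
    proof -
      have "a < E" if "a \<le> 2 * b + 2 * c" "b < E / 4" "c < E / 4" for a b c E :: real
        using that by linarith
      then have "(norm (X m - X n))\<^sup>2 < e\<^sup>2" using dist[of m n] K[OF that(1)] K[OF that(2)] .
      then show ?thesis
        unfolding dist_norm using \<open>0 < e\<close> by (auto intro: power2_less_imp_less)
    qed
    then show "\<exists>K. \<forall>m\<ge>K. \<forall>n\<ge>K. dist (X m) (X n) < e" by blast
  qed
  then obtain x where x: "X \<longlonglongrightarrow> x"
    using Cauchy_convergent unfolding convergent_def by blast
  have norm_x: "norm x = d"
    using LIMSEQ_unique[OF tendsto_norm[OF x] lim] .
  have f_diff: "f (a - b) = f a - f b" for a b
    using add[of "a - b" b] by simp
  \<comment> \<open>Here 1 - f x = f (X n - x) for every n, so this constant sequence is bounded by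
    M times the distance to the limit.\<close>
  have "(\<lambda>n. 1 - f x) \<longlonglongrightarrow> 0"
  proof (rule tendsto_0_le[where K = 1 and f = "\<lambda>n. M * norm (X n - x)"])
    show "eventually (\<lambda>n. norm (1 - f x) \<le> norm (M * norm (X n - x)) * 1) sequentially"
      using order_trans[OF bound[of "X n - x" for n] abs_ge_self] by (simp add: f_diff X(1))
    show "(\<lambda>n. M * norm (X n - x)) \<longlonglongrightarrow> 0"
      using tendsto_mult_right_zero[OF tendsto_norm_zero[OF LIM_zero[OF x]]] .
  qed
  then have "f x = 1"
    unfolding LIMSEQ_const_iff by simp
  then show ?thesis using norm_x d_le by auto
qed

theorem riesz_representation:
  fixes f :: "'a::complex_hilbert \<Rightarrow> complex"
  assumes add: "\<And>x y. f (x + y) = f x + f y" and scale: "\<And>c x. f (c *\<^sub>C x) = c * f x"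
    and bound: "\<And>x. cmod (f x) \<le> M * norm x"
  shows "\<exists>\<eta>. \<forall>x. f x = cinner x \<eta>"
proof (cases "\<exists>z. f z \<noteq> 0")
  case False
  then show ?thesis by (intro exI[of _ 0]) simp
next
  case True
  then obtain x where x: "f x = 1" and min: "\<And>y. f y = 1 \<Longrightarrow> norm x \<le> norm y"
    using minimal_norm_exists[OF add scale bound] by blast
  have f_diff: "f (a - b) = f a - f b" for a b
    using add[of "a - b" b] by simp
  have "x \<noteq> 0" using x scale[of 0 0] by auto
  have "f z = cinner z ((1 / cinner x x) *\<^sub>C x)" for z
  proof -
    \<comment> \<open>The vector z - f z x lies in the kernel of f. Adding its multiples to x stays
      in the hyperplane, so minimality of x gives orthogonality.\<close>
    have "cinner (z - f z *\<^sub>C x) x = 0"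
      by (intro orthogonal_of_minimal min) (simp add: f_diff scale x)
    then have "cinner z x = f z * cinner x x"
      by (simp add: cinner_diff_left cinner_scaleC_left)
    moreover have "cnj (cinner x x) = cinner x x" using cinner_commute[of x x] by simp
    ultimately show ?thesis
      using \<open>x \<noteq> 0\<close> by (simp add: cinner_scaleC_right cinner_eq_zero_iff)
  qed
  then show ?thesis by blast
qed

section \<open>Dimension and rank-one operators\<close>

lemma clinear_iff:
  "clinear f \<longleftrightarrow> (\<forall>x y. f (x + y) = f x + f y) \<and> (\<forall>c x. f (c *\<^sub>C x) = c *\<^sub>C f x)"
  by (auto simp: Vector_Spaces.linear_def module_hom_def module_hom_axioms_def
      complex_vector.vector_space_axioms complex_vector.module_axioms)

lemma cdim_one_imp_span:
  assumes "cdim S = 1"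
  shows "\<exists>b. b \<noteq> 0 \<and> cspan S = cspan {b}"
proof -
  have "complex_vector.dim S = 1"
    using assms by (auto simp: cdim_def one_enat_def split: if_splits)
  obtain B where B: "B \<subseteq> S" "complex_vector.independent B" "S \<subseteq> cspan B" "card B = complex_vector.dim S"
    by (rule complex_vector.basis_exists)
  then have "card B = 1" using \<open>complex_vector.dim S = 1\<close> by simp
  then obtain b where "B = {b}" by (auto simp: card_1_singleton_iff)
  then have "b \<noteq> 0" using B complex_vector.dependent_zero by blast
  moreover have "cspan S = cspan {b}"
    using B \<open>B = {b}\<close> complex_vector.span_mono complex_vector.span_minimal complex_vector.subspace_span
    by (metis subset_antisym)
  ultimately show ?thesis by blast
qed

lemma cdim_eq_one:
  assumes "cspan S = cspan {b}" "b \<noteq> 0"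
  shows "cdim S = 1"
proof -
  have "complex_vector.independent {b}" using assms(2) by simp
  then have "complex_vector.dim (cspan S) = 1"
    using complex_vector.dim_span_eq_card_independent assms(1) by fastforce
  moreover have "\<exists>B. finite B \<and> cspan B = cspan S"
    using assms(1) by (metis finite.emptyI finite_insert)
  ultimately show ?thesis by (simp add: cdim_def one_enat_def)
qed

lemma two_independent:
  assumes "cdim (UNIV :: 'a::complex_vector set) \<ge> 2"
  shows "\<exists>y z::'a. y \<noteq> 0 \<and> (\<nexists>k. z = k *\<^sub>C y)"
proof (rule ccontr)
  assume neg: "\<not> ?thesis"
  show False
  proof (cases "\<exists>y::'a. y \<noteq> 0")
    case True
    then obtain y :: 'a where y: "y \<noteq> 0" by blast
    then have "cspan {y} = UNIV"
      using neg unfolding complex_vector.span_singleton by blast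
    then have "cdim (UNIV :: 'a set) = 1"
      using cdim_eq_one[of UNIV y] y by simp
    then show False using assms by (simp add: numeral_eq_enat one_enat_def)
  next
    case False
    then have 0: "UNIV = {0::'a}" by auto
    have "complex_vector.dim (UNIV :: 'a set) = 0"
      using complex_vector.dim_span_eq_card_independent[OF complex_vector.independent_empty]
      by (simp add: 0)
    moreover have "\<exists>B. finite B \<and> cspan B = cspan (UNIV :: 'a set)"
      unfolding 0 by blast
    ultimately show False using assms by (simp add: cdim_def numeral_eq_enat)
  qed
qed

lemma rank_one_op_add_left: "(x + x') \<otimes> y = x \<otimes> y + x' \<otimes> y"
  by (simp add: rank_one_op_def fun_eq_iff complex_vector.scale_right_distrib)

lemma rank_one_op_add_right: "x \<otimes> (y + y') = x \<otimes> y + x \<otimes> y'"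
  by (simp add: rank_one_op_def fun_eq_iff cinner_add_right complex_vector.scale_left_distrib)

lemma rank_one_op_scale_left: "(c *\<^sub>C x) \<otimes> y = c *\<^sub>C (x \<otimes> y)"
  by (simp add: rank_one_op_def fun_eq_iff scaleC_fun_def mult.commute)

lemma rank_one_op_scale_right: "x \<otimes> (c *\<^sub>C y) = cnj c *\<^sub>C (x \<otimes> y)"
  by (simp add: rank_one_op_def fun_eq_iff scaleC_fun_def cinner_scaleC_right)

lemma rank_one_op_eq_zero: "x \<otimes> y = 0 \<Longrightarrow> x = 0 \<or> y = 0"
proof -
  assume "x \<otimes> y = 0"
  then have "cinner y y *\<^sub>C x = 0" by (metis rank_one_op_def zero_fun_apply)
  then show ?thesis by (auto simp: cinner_eq_zero_iff)
qed

text \<open>If y is not parallel to y', evaluating at a vector orthogonal to y' but not to y shows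
  that p is parallel to x. Evaluating at y' then shows the same for x'.\<close>

lemma rank_one_op_sum:
  assumes eq: "x \<otimes> y + x' \<otimes> y' = p \<otimes> q" and "x' \<noteq> 0" "y' \<noteq> 0"
  shows "(\<exists>k. x = k *\<^sub>C x') \<or> (\<exists>k. y = k *\<^sub>C y')"
proof (rule ccontr)
  assume neg: "\<not> ?thesis"
  have at: "cinner z y *\<^sub>C x + cinner z y' *\<^sub>C x' = cinner z q *\<^sub>C p" for z
    using fun_cong[OF eq, of z] by (simp add: rank_one_op_def)
  have y': "cinner y' y' \<noteq> 0" using assms by (simp add: cinner_eq_zero_iff)
  \<comment> \<open>The component of y orthogonal to y'.\<close>
  define z where "z = y - (cinner y y' / cinner y' y') *\<^sub>C y'"
  have "z \<noteq> 0" using neg unfolding z_def by auto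
  have zy': "cinner z y' = 0" using y' by (simp add: z_def cinner_diff_left cinner_scaleC_left)
  have "cinner z y = cinner z (z + (cinner y y' / cinner y' y') *\<^sub>C y')" by (simp add: z_def)
  also have "\<dots> = cinner z z" by (simp only: cinner_add_right cinner_scaleC_right zy') simp
  finally have zy: "cinner z y \<noteq> 0" using \<open>z \<noteq> 0\<close> by (simp add: cinner_eq_zero_iff)
  have "x \<noteq> 0" using neg by (metis complex_vector.scale_zero_left)
  have x: "cinner z y *\<^sub>C x = cinner z q *\<^sub>C p" using at[of z] zy' by simp
  then have zq: "cinner z q \<noteq> 0" using zy \<open>x \<noteq> 0\<close> by auto
  have p: "p = (cinner z y / cinner z q) *\<^sub>C x"
  proof -
    have "p = (1 / cinner z q) *\<^sub>C cinner z q *\<^sub>C p" using zq by simp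
    then show ?thesis unfolding x[symmetric] by simp
  qed
  define k where "k = cinner y' q * (cinner z y / cinner z q) - cinner y' y"
  have k: "cinner y' y' *\<^sub>C x' = k *\<^sub>C x"
    using at[of y'] unfolding p k_def
    by (simp add: complex_vector.scale_left_diff_distrib algebra_simps)
  then have "k \<noteq> 0" using y' assms by auto
  then have "x = (1 / k) *\<^sub>C k *\<^sub>C x" by simp
  then have "x = (cinner y' y' / k) *\<^sub>C x'" unfolding k[symmetric] by simp
  then show False using neg by blast
qed

lemma clinear_rank_one_op: "clinear (x \<otimes> y)"
  by (simp add: clinear_iff rank_one_op_def cinner_add_left cinner_scaleC_left
      complex_vector.scale_left_distrib)

lemma crank_rank_one_op:
  assumes "x \<noteq> 0" "y \<noteq> 0"
  shows "crank (x \<otimes> y) = 1"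
proof -
  have "c *\<^sub>C x \<in> range (x \<otimes> y)" for c
    using assms by (intro range_eqI[of _ _ "(c / cinner y y) *\<^sub>C y"])
      (simp add: rank_one_op_def cinner_scaleC_left cinner_eq_zero_iff)
  then have "range (x \<otimes> y) = cspan {x}"
    unfolding complex_vector.span_singleton by (auto simp: rank_one_op_def)
  then show ?thesis
    unfolding crank_def using assms by (intro cdim_eq_one[of _ x]) (simp_all add: complex_vector.span_span)
qed

text \<open>The operator takes values in a line, and its coordinate along a spanning vector b is a
  bounded functional, to which Riesz applies.\<close>

lemma bounded_rank_one:
  fixes T :: "'h::complex_hilbert \<Rightarrow> 'k::complex_hilbert"
  assumes "T \<in> bounded_ops" "crank T = 1"
  shows "\<exists>x y. x \<noteq> 0 \<and> y \<noteq> 0 \<and> T = x \<otimes> y"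
proof -
  from assms(1) obtain M where lin: "\<And>x y. T (x + y) = T x + T y" "\<And>c x. T (c *\<^sub>C x) = c *\<^sub>C T x"
    and M: "\<And>x. norm (T x) \<le> M * norm x"
    by (auto simp: bounded_ops_def clinear_iff)
  from assms(2) obtain b where b: "b \<noteq> 0" "cspan (range T) = cspan {b}"
    using cdim_one_imp_span unfolding crank_def by blast
  have "\<exists>c. T z = c *\<^sub>C b" for z
  proof -
    have "T z \<in> cspan {b}" unfolding b(2)[symmetric] by (simp add: complex_vector.span_base)
    then show ?thesis by (auto simp: complex_vector.span_singleton)
  qed
  then obtain f where f: "\<And>z. T z = f z *\<^sub>C b" by metis
  have "\<exists>\<eta>. \<forall>x. f x = cinner x \<eta>"
  proof (rule riesz_representation)
    show "f (x + y) = f x + f y" for x y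
      using lin(1)[of x y] b(1) unfolding f by (simp flip: complex_vector.scale_left_distrib)
    show "f (c *\<^sub>C x) = c * f x" for c x
      using lin(2)[of c x] b(1) unfolding f by simp
    show "cmod (f x) \<le> (M / norm b) * norm x" for x
      using M[of x] b(1) unfolding f by (simp add: norm_scaleC field_simps)
  qed
  then obtain \<eta> where "\<And>x. f x = cinner x \<eta>" by blast
  then have T: "T = b \<otimes> \<eta>" by (simp add: f rank_one_op_def fun_eq_iff)
  have "\<eta> \<noteq> 0"
  proof
    assume "\<eta> = 0"
    then have "range T \<subseteq> {0}" by (auto simp: T rank_one_op_def)
    then have "cspan (range T) \<subseteq> cspan {0}" by (rule complex_vector.span_mono)
    moreover have "b \<in> cspan (range T)" unfolding b(2) by (simp add: complex_vector.span_base)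
    ultimately show False using b(1) by auto
  qed
  with b(1) T show ?thesis by blast
qed

section \<open>Bounded operators and the socle\<close>

lemma subspace_bounded_ops:
  "complex_vector.subspace (bounded_ops :: ('h::complex_hilbert \<Rightarrow> 'k::complex_hilbert) set)"
proof (rule complex_vector.subspaceI)
  show "(0 :: 'h \<Rightarrow> 'k) \<in> bounded_ops"
    by (auto simp: bounded_ops_def clinear_iff intro: exI[of _ 0])
next
  fix S T :: "'h \<Rightarrow> 'k" assume "S \<in> bounded_ops" "T \<in> bounded_ops"
  then obtain M N where lin: "clinear S" "clinear T"
    and "\<And>x. norm (S x) \<le> M * norm x" "\<And>x. norm (T x) \<le> N * norm x"
    by (auto simp: bounded_ops_def)
  then have "norm ((S + T) x) \<le> (M + N) * norm x" for x
    by (auto simp: distrib_right intro!: order_trans[OF norm_triangle_ineq] add_mono)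
  moreover have "clinear (S + T)"
    using lin by (simp add: clinear_iff complex_vector.scale_right_distrib algebra_simps)
  ultimately show "S + T \<in> bounded_ops" unfolding bounded_ops_def by blast
next
  fix c and T :: "'h \<Rightarrow> 'k" assume "T \<in> bounded_ops"
  then obtain M where lin: "clinear T" and "\<And>x. norm (T x) \<le> M * norm x"
    by (auto simp: bounded_ops_def)
  then have "norm ((c *\<^sub>C T) x) \<le> (cmod c * M) * norm x" for x
    by (simp add: scaleC_fun_def norm_scaleC mult.assoc mult_left_mono)
  moreover have "clinear (c *\<^sub>C T)"
    using lin by (simp add: clinear_iff scaleC_fun_def complex_vector.scale_right_distrib mult.commute)
  ultimately show "c *\<^sub>C T \<in> bounded_ops" unfolding bounded_ops_def by blast
qed

lemma soc_subset_bounded_ops: "soc \<subseteq> bounded_ops"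
  unfolding soc_def
  by (rule complex_vector.span_minimal[OF _ subspace_bounded_ops]) (auto simp: partial_isometry_def)

text \<open>The orthogonal complement of the kernel is the line of y, on which the operator
  preserves norms because both vectors are units.\<close>

lemma partial_isometry_rank_one_op:
  fixes x :: "'k::complex_hilbert" and y :: "'h::complex_hilbert"
  assumes "norm x = 1" "norm y = 1"
  shows "partial_isometry (x \<otimes> y)"
  unfolding partial_isometry_def
proof (intro conjI allI impI)
  have norm: "norm ((x \<otimes> y) z) = cmod (cinner z y)" for z
    using assms by (simp add: rank_one_op_def norm_scaleC)
  have "norm ((x \<otimes> y) z) \<le> 1 * norm z" for z
  proof -
    have "0 \<le> (norm z)\<^sup>2 - (cmod (cinner z y))\<^sup>2"
      using cmod_cinner_unit[OF assms(2), of z] by (metis zero_le_power2)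
    then show ?thesis unfolding norm by (auto intro: power2_le_imp_le)
  qed
  then show "x \<otimes> y \<in> bounded_ops"
    unfolding bounded_ops_def using clinear_rank_one_op by blast
  fix z assume z: "\<forall>w. (x \<otimes> y) w = 0 \<longrightarrow> cinner z w = 0"
  \<comment> \<open>This component lies in the kernel, so z is orthogonal to it; being also
    orthogonal to y, it is orthogonal to itself.\<close>
  define w where "w = z - cinner z y *\<^sub>C y"
  have wy: "cinner w y = 0"
    using assms by (simp add: w_def cinner_diff_left cinner_scaleC_left cinner_self)
  then have "cinner z w = 0" using z by (simp add: rank_one_op_def)
  then have "cinner w z = 0" using cinner_commute[of w z] by simp
  then have "cinner w w = 0"
    using wy by (simp add: w_def cinner_diff_right cinner_scaleC_right)
  then have "w = 0" by (simp add: cinner_eq_zero_iff)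
  then show "norm ((x \<otimes> y) z) = norm z"
    using cmod_cinner_unit[OF assms(2), of z] unfolding norm w_def
    by (auto intro: power2_eq_imp_eq)
qed

text \<open>Normalizing both vectors gives a generator of the span, up to the product of the
  norms.\<close>

lemma rank_one_op_in_soc: "x \<otimes> y \<in> soc"
proof (cases "x = 0 \<or> y = 0")
  case True
  then have "x \<otimes> y = 0" by (auto simp: rank_one_op_def fun_eq_iff)
  then show ?thesis unfolding soc_def by (simp add: complex_vector.span_zero)
next
  case False
  define a where "a = (1 / complex_of_real (norm x)) *\<^sub>C x"
  define b where "b = (1 / complex_of_real (norm y)) *\<^sub>C y"
  have n: "norm a = 1" "norm b = 1"
    using False by (simp_all add: a_def b_def norm_scaleC norm_divide)
  then have nz: "a \<noteq> 0" "b \<noteq> 0" by auto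
  have "a \<otimes> b \<in> soc"
    unfolding soc_def using partial_isometry_rank_one_op[OF n] crank_rank_one_op[OF nz]
    by (simp add: complex_vector.span_base)
  then have "complex_of_real (norm x * norm y) *\<^sub>C (a \<otimes> b) \<in> soc"
    unfolding soc_def by (rule complex_vector.span_scale)
  moreover have "complex_of_real (norm x * norm y) *\<^sub>C (a \<otimes> b) = x \<otimes> y"
    using False by (simp add: a_def b_def rank_one_op_scale_left rank_one_op_scale_right)
  ultimately show ?thesis by simp
qed

lemma tensor_rank_one_op:
  "tensor (\<lambda>(x::'k::complex_hilbert) (y::'h::complex_hilbert). x \<otimes> y) id"
proof
  show "x = 0 \<or> y = 0" if "x \<otimes> y = 0" for x :: 'k and y :: 'h
    using that by (rule rank_one_op_eq_zero)
  show "(\<exists>k. x = k *\<^sub>C x') \<or> (\<exists>k. y = k *\<^sub>C y')"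
    if "x \<otimes> y + x' \<otimes> y' = p \<otimes> q" "x' \<noteq> 0" "y' \<noteq> 0" for x x' p :: 'k and y y' q :: 'h
    using that by (rule rank_one_op_sum)
qed (simp_all add: rank_one_op_add_left rank_one_op_add_right rank_one_op_scale_left
    rank_one_op_scale_right)

section \<open>Linear bijections of socles preserving rank one\<close>

theorem theorem4p3:
  fixes \<Phi> :: "('h1::complex_hilbert \<Rightarrow> 'k1::complex_hilbert) \<Rightarrow>
               ('h2::complex_hilbert \<Rightarrow> 'k2::complex_hilbert)"
  assumes "cdim (UNIV :: 'h1 set) \<ge> 2" and "cdim (UNIV :: 'h2 set) \<ge> 2"
    and "cdim (UNIV :: 'k1 set) \<ge> 2" and "cdim (UNIV :: 'k2 set) \<ge> 2"
    and "bij_betw \<Phi> soc soc"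
    and "linear_on_soc \<Phi>"
    and "\<forall>x\<in>soc. crank x = 1 \<longleftrightarrow> crank (\<Phi> x) = 1"
  shows "(\<exists>(u :: 'k1 \<Rightarrow> 'k2) (v :: 'h1 \<Rightarrow> 'h2).
            clinear u \<and> bij u \<and> clinear v \<and> bij v \<and>
            (\<forall>\<xi> \<eta>. \<Phi> (\<xi> \<otimes> \<eta>) = u \<xi> \<otimes> v \<eta>)) \<or>
         (\<exists>(u :: 'h1 \<Rightarrow> 'k2) (v :: 'k1 \<Rightarrow> 'h2).
            conjugate_linear u \<and> bij u \<and> conjugate_linear v \<and> bij v \<and>
            (\<forall>\<xi> \<eta>. \<Phi> (\<xi> \<otimes> \<eta>) = u \<eta> \<otimes> v \<xi>))"
proof -
  have inj: "inj_on \<Phi> soc" and img: "\<Phi> ` soc = soc"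
    using assms(5) by (auto simp: bij_betw_def)
  have add: "\<Phi> (S + T) = \<Phi> S + \<Phi> T" if "S \<in> soc" "T \<in> soc" for S T
    using assms(6) that by (simp add: linear_on_soc_def)
  have scale: "\<Phi> (c *\<^sub>C S) = c *\<^sub>C \<Phi> S" if "S \<in> soc" for c S
    using assms(6) that by (simp add: linear_on_soc_def)
  have zero_soc: "(0 :: 'h1 \<Rightarrow> 'k1) \<in> soc"
    unfolding soc_def by (rule complex_vector.span_zero)
  have sum_soc: "S + T \<in> soc" if "S \<in> soc" "T \<in> soc" for S T :: "'h1 \<Rightarrow> 'k1"
    using that unfolding soc_def by (rule complex_vector.span_add)
  have \<Phi>_zero: "\<Phi> 0 = 0"
    using scale[OF zero_soc, of 0] by simp
  define F where "F \<xi> \<eta> = \<Phi> (\<xi> \<otimes> \<eta>)" for \<xi> \<eta>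
  interpret s: tensor "\<lambda>(\<xi>::'k1) (\<eta>::'h1). \<xi> \<otimes> \<eta>" id by (rule tensor_rank_one_op)
  interpret t: tensor "\<lambda>(\<xi>::'k2) (\<eta>::'h2). \<xi> \<otimes> \<eta>" id by (rule tensor_rank_one_op)
  have decomposable: "\<exists>p q. F \<xi> \<eta> = p \<otimes> q" for \<xi> \<eta>
  proof (cases "\<xi> = 0 \<or> \<eta> = 0")
    case True
    then have "F \<xi> \<eta> = 0 \<otimes> 0" unfolding F_def using s.eq_zero_iff t.eq_zero_iff \<Phi>_zero by metis
    then show ?thesis by blast
  next
    case False
    then have "crank (F \<xi> \<eta>) = 1"
      unfolding F_def using assms(7) rank_one_op_in_soc crank_rank_one_op by blast
    moreover have "F \<xi> \<eta> \<in> bounded_ops"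
      unfolding F_def using img rank_one_op_in_soc soc_subset_bounded_ops by blast
    ultimately show ?thesis using bounded_rank_one by blast
  qed
  \<comment> \<open>Surjectivity and the backward direction of rank preservation give a rank-one
    preimage, which is again elementary.\<close>
  have onto: "\<exists>\<xi> \<eta>. p \<otimes> q = F \<xi> \<eta>" for p q
  proof (cases "p = 0 \<or> q = 0")
    case True
    then have "p \<otimes> q = F 0 0" unfolding F_def using s.zero_left t.eq_zero_iff \<Phi>_zero by metis
    then show ?thesis by blast
  next
    case False
    obtain T where T: "T \<in> soc" "p \<otimes> q = \<Phi> T" using img rank_one_op_in_soc by blast
    then have "crank T = 1" using False crank_rank_one_op assms(7) by metis
    then obtain \<xi> \<eta> where "T = \<xi> \<otimes> \<eta>"
      using bounded_rank_one T(1) soc_subset_bounded_ops by blast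
    then show ?thesis using T unfolding F_def by blast
  qed
  have F: "tensor F id"
  proof
    show "F (x + x') y = F x y + F x' y" for x x' y
      by (simp add: F_def rank_one_op_add_left add rank_one_op_in_soc)
    show "F x (y + y') = F x y + F x y'" for x y y'
      by (simp add: F_def rank_one_op_add_right add rank_one_op_in_soc)
    show "F (c *\<^sub>C x) y = id c *\<^sub>C F x y" for c x y
      by (simp add: F_def rank_one_op_scale_left scale rank_one_op_in_soc)
    show "F x (c *\<^sub>C y) = cnj (id c) *\<^sub>C F x y" for c x y
      by (simp add: F_def rank_one_op_scale_right scale rank_one_op_in_soc)
    show "x = 0 \<or> y = 0" if "F x y = 0" for x y
    proof -
      have "x \<otimes> y = 0"
        using that inj \<Phi>_zero zero_soc rank_one_op_in_soc unfolding F_def by (metis inj_on_def)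
      then show ?thesis by (rule rank_one_op_eq_zero)
    qed
    show "(\<exists>k. x = k *\<^sub>C x') \<or> (\<exists>k. y = k *\<^sub>C y')"
      if sum: "F x y + F x' y' = F p q" and nz: "x' \<noteq> 0" "y' \<noteq> 0" for x y x' y' p q
    proof -
      \<comment> \<open>Injectivity pulls the equation back to the source, where
        \<open>rank_one_op_sum\<close> applies.\<close>
      have "\<Phi> (x \<otimes> y + x' \<otimes> y') = \<Phi> (p \<otimes> q)"
        using sum by (simp add: F_def add rank_one_op_in_soc)
      then have "x \<otimes> y + x' \<otimes> y' = p \<otimes> q"
        using inj_onD[OF inj] sum_soc rank_one_op_in_soc by blast
      then show ?thesis using nz by (rule rank_one_op_sum)
    qed
  qed simp
  obtain y\<^sub>1 y\<^sub>2 :: 'h1 where y: "y\<^sub>1 \<noteq> 0" "\<nexists>k. y\<^sub>2 = k *\<^sub>C y\<^sub>1"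
    using two_independent[OF assms(1)] by blast
  have x: "\<exists>x::'k1. x \<noteq> 0"
    using two_independent[OF assms(3)] by blast
  interpret F: tensor F id by (rule F)
  interpret pair: tensor_pair F id "\<lambda>\<xi> \<eta>. \<xi> \<otimes> \<eta>" id y\<^sub>1 y\<^sub>2
    by unfold_locales (use decomposable onto y x in metis)+
  interpret swap: tensor_pair F id "\<lambda>\<eta> \<xi>. \<xi> \<otimes> \<eta>" "\<lambda>c. cnj (id c)" y\<^sub>1 y\<^sub>2
    by (rule pair.tensor_pair_swap)
  \<comment> \<open>Right type for the pair is left type for the swapped pair.\<close>
  consider "\<And>x. pair.left_type x" | "\<And>x. swap.left_type x"
    using pair.uniform_type unfolding pair.right_type_def swap.left_type_def by blast
  then show ?thesis
  proof cases
    case 1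
    from pair.left_type_factors[OF 1] show ?thesis
      unfolding clinear_iff F_def by (intro disjI1) simp
  next
    case 2
    \<comment> \<open>After the swap the twists are \<open>id\<close> and \<open>cnj\<close>, so
      both maps are conjugate-linear; the map on the first argument now lands in the second target
      space.\<close>
    from swap.left_type_factors[OF 2] obtain v :: "'k1 \<Rightarrow> 'h2" and u :: "'h1 \<Rightarrow> 'k2"
      where "conjugate_linear v" "bij v" "conjugate_linear u" "bij u"
        and "\<And>\<xi> \<eta>. F \<xi> \<eta> = u \<eta> \<otimes> v \<xi>"
      unfolding conjugate_linear_def by auto
    then show ?thesis unfolding F_def by blast
  qed
qed

end
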